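(* Let $n\ge 0$ be an integer. For every integer $k$ with $0\le k\le n$: (a) the number of Franel $n$-deals with exactly $k$ green cards in red's hand is $\binom{n}{k}^{3}$; equivalently, the number of $2\times n$ abelian matrices over $\{1,2,3\}$ that have no column $\left(\begin{smallmatrix}1\\1\end{smallmatrix}\right)$ and have exactly $k$ columns $\left(\begin{smallmatrix}p\\ q\end{smallmatrix}\right)$ (top entry $p$, bottom entry $q$) with $p>1$ and $q<3$ is $\binom{n}{k}^{3}$; (b) the number of Franel $n$-deals with exactly $k$ distinct denominations in red's hand is $\binom{n}{k}^{2}\binom{2k}{n}$; equivalently, the number of $2\times n$ abelian matrices over $\{1,2,3\}$ that have no column $\left(\begin{smallmatrix}1\\1\end{smallmatrix}\right)$ and have a total of exactly $k$ entries equal to $2$ or $3$ in each row is $\binom{n}{k}^{2}\binom{2k}{n}$. Thus the two sides of $\sum_{k=0}^{n}\binom{n}{k}^{3}=\sum_{k=0}^{n}\binom{n}{k}^{2}\binom{2k}{n}$ count the Franel $n$-deals by number $k$ of green cards in red's hand and by number $k$ of distinct denominations in red's hand, respectively.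
   Context: A Franel $n$-deal is formed as follows. Take a deck of $3n$ cards, $n$ each colored red, green and blue, with one card of each color in each denomination $1,\dots,n$. Deal all $3n$ cards into three equal-size hands (of $n$ cards each) to three players designated red, green and blue, in such a way that no player receives a card of her own color. A deal is determined by the set of cards in each hand. A $2\times n$ abelian matrix over $\{1,2,3\}$ is a $2\times n$ matrix with entries in $\{1,2,3\}$ whose bottom row is a rearrangement of its top row. Convention: $\binom{m}{r}=0$ if $r>m\ge 0$. *)

theory Defs
  imports "HOL-Library.Disjoint_Sets" "HOL-Library.Multiset" "Jordan_Normal_Form.Matrix"
begin

text \<open>The three colors name both the colors of the cards and the three players.\<close>

datatype color = Red | Green | Blue

type_synonym card = "color \<times> nat"

definition deck :: "nat \<Rightarrow> card set" where
  "deck n = UNIV \<times> {1..n}"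

text \<open>A deal maps each player to her hand.\<close>

definition franel_deals :: "nat \<Rightarrow> (color \<Rightarrow> card set) set" where
  "franel_deals n = {d. disjoint_family d \<and> (\<Union>p. d p) = deck n \<and>
     (\<forall>p. card (d p) = n) \<and> (\<forall>p. \<forall>c \<in> d p. fst c \<noteq> p)}"

definition green_in_red :: "(color \<Rightarrow> card set) \<Rightarrow> nat" where
  "green_in_red d = card {c \<in> d Red. fst c = Green}"

definition denominations_in_red :: "(color \<Rightarrow> card set) \<Rightarrow> nat" where
  "denominations_in_red d = card (snd ` d Red)"

text \<open>Rows and columns are indexed from 0: row 0 is the top row, row 1 the bottom row.\<close>

definition abelian_matrices :: "nat \<Rightarrow> nat mat set" where
  "abelian_matrices n = {M \<in> carrier_mat 2 n. elements_mat M \<subseteq> {1, 2, 3} \<and>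
     mset (list_of_vec (row M 1)) = mset (list_of_vec (row M 0))}"

definition no_column_11 :: "nat mat \<Rightarrow> bool" where
  "no_column_11 M \<longleftrightarrow> (\<forall>j < dim_col M. \<not> (M $$ (0, j) = 1 \<and> M $$ (1, j) = 1))"

end

theory Submission
  imports Defs
begin

text \<open>
Deals and matrices are two encodings of one simple object: a triple \<open>(X, Y, Z)\<close> of subsets of an
\<open>n\<close>-element set \<open>S\<close>, all of the same size.

In a deal, each card goes to one of the two players whose color it does not have, so a deal amounts
to one binary choice for each of the \<open>3 * n\<close> cards. Let \<open>X\<close>, \<open>Y\<close>, \<open>Z\<close> be the denominations of
the green cards in red's hand, the blue cards in green's hand and the red cards in blue's hand. The
hand of red then has \<open>card X + (n - card Y)\<close> cards, and cyclically, so that the three hands have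
\<open>n\<close> cards each iff the three sets have the same size (\<open>bij_betw_deal_of_triple\<close>).

In a matrix without a column of two ones, each column is one of \<open>9 - 1 = 2 ^ 3\<close> possible columns,
so it can record three memberships. The columns are assigned to the membership patterns so that
having as many ones (or twos) on top as at the bottom means precisely \<open>card X = card Y\<close>
(or \<open>card Y = card Z\<close>), see \<open>bij_betw_matrix_of_triple\<close>.

Both encodings turn the first statistic into \<open>card X\<close>, and with \<open>card X = k\<close> the three sets can
be chosen independently, which gives the cube of a binomial coefficient. Both encodings turn the
second statistic into \<open>card (X \<union> (S - Y))\<close>: the complement \<open>Y - X\<close> of that set consists of the
denominations of which red has neither card, and of the columns whose top entry is one. The triples
with a given value of this statistic are counted in \<open>card_equicard_triples_by_union\<close> by choosing
\<open>Y - X\<close> and \<open>X - Y\<close>, which have the same size, and then \<open>X \<inter> Y\<close> together with \<open>Z\<close>. Summing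
either count over \<open>k\<close> gives the number of all deals, hence the identity.
\<close>

section \<open>Triples of equinumerous subsets\<close>

definition equicard_triples :: "'a set \<Rightarrow> ('a set \<times> 'a set \<times> 'a set) set" where
  "equicard_triples S = {(X, Y, Z). X \<subseteq> S \<and> Y \<subseteq> S \<and> Z \<subseteq> S \<and> card X = card Y \<and> card Y = card Z}"

lemma finite_equicard_triples: "finite S \<Longrightarrow> finite (equicard_triples S)"
  by (rule finite_subset[of _ "Pow S \<times> Pow S \<times> Pow S"]) (auto simp: equicard_triples_def)

lemma card_equicard_triples_by_size:
  assumes "finite S"
  shows "card {(X, Y, Z) \<in> equicard_triples S. card X = k} = (card S choose k) ^ 3"
proof -
  let ?K = "{A. A \<subseteq> S \<and> card A = k}"
  have "{(X, Y, Z) \<in> equicard_triples S. card X = k} = ?K \<times> ?K \<times> ?K"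
    by (auto simp: equicard_triples_def)
  then show ?thesis
    using n_subsets[OF assms, of k] by (simp add: card_cartesian_product power3_eq_cube)
qed

text \<open>The two sets share the intersection.\<close>

lemma card_eq_iff_card_Diff_eq:
  assumes "finite A" "finite B"
  shows "card A = card B \<longleftrightarrow> card (A - B) = card (B - A)"
  using card_Int_Diff[OF assms(1), of B] card_Int_Diff[OF assms(2), of A]
  by (simp add: Int_commute)

text \<open>
Apart from a common factor \<open>n choose k\<close>, both sides count the chains of a \<open>k\<close>-set in an \<open>n\<close>-set
in a fixed set of size \<open>2 * k\<close>, starting with the smaller or the larger set. For \<open>2 * k < n\<close> both sides vanish, as no \<open>k\<close>-set has a subset of size \<open>n - k\<close>.
\<close>

lemma choose_product_identity:
  assumes "k \<le> n"
  shows "(n choose k) * ((k choose (n - k)) * ((2 * k) choose k)) = (n choose k) ^ 2 * ((2 * k) choose n)"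
proof (cases "n \<le> 2 * k")
  case True
  have "(2 * k choose n) * (n choose k) = (2 * k choose k) * ((2 * k - k) choose (n - k))"
    using choose_mult[OF assms True] .
  then have "(2 * k choose n) * (n choose k) = (2 * k choose k) * (k choose (n - k))"
    by simp
  then show ?thesis
    by (simp add: power2_eq_square mult_ac)
next
  case False
  then show ?thesis by (simp add: binomial_eq_0)
qed

text \<open>
With \<open>U = Y - X\<close> and \<open>V = X - Y\<close>, the condition says that \<open>U\<close> has size \<open>n - k\<close>, and \<open>V\<close> has the
same size because \<open>X\<close> and \<open>Y\<close> do. It remains to choose \<open>P = X \<inter> Y\<close> outside \<open>U \<union> V\<close> and \<open>Z\<close> with
\<open>card Z = n - k + card P\<close>. In terms of the complement \<open>R = S - Z\<close> this reads \<open>card P + card R = k\<close>,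
so the pairs \<open>(P, R)\<close> are the \<open>k\<close>-subsets of a disjoint sum of size \<open>(2 * k - n) + n = 2 * k\<close>;
this is the Vandermonde convolution in bijective form. The three stages give
\<open>(n choose k) * (k choose (n - k)) * (2 * k choose k)\<close>.
\<close>

lemma card_equicard_triples_by_union:
  fixes S :: "'a set"
  assumes "finite S" and "k \<le> card S"
  shows "card {(X, Y, Z) \<in> equicard_triples S. card (X \<union> (S - Y)) = k}
    = (card S choose k) ^ 2 * ((2 * k) choose card S)"
proof -
  define n where "n = card S"
  define T where "T = {(X, Y, Z) \<in> equicard_triples S. card (X \<union> (S - Y)) = k}"
  define C where "C = (SIGMA U:{U. U \<subseteq> S \<and> card U = n - k}.
    SIGMA V:{V. V \<subseteq> S - U \<and> card V = n - k}. {Q. Q \<subseteq> (S - U - V) <+> S \<and> card Q = k})"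
  define f where "f = (\<lambda>(X :: 'a set, Y :: 'a set, Z). (Y - X, X - Y, (X \<inter> Y) <+> (S - Z :: 'a set)))"
  define g where "g = (\<lambda>(U, V, Q :: ('a + 'a) set). (V \<union> Inl -` Q, U \<union> Inl -` Q, S - (Inr -` Q :: 'a set)))"
  have fin: "finite A" if "A \<subseteq> S" for A
    using that assms(1) finite_subset by blast
  have le: "card A \<le> n" if "A \<subseteq> S" for A
    using that assms(1) card_mono n_def by blast
  have fC: "f t \<in> C" and gf: "g (f t) = t" if "t \<in> T" for t
  proof -
    obtain X Y Z where t: "t = (X, Y, Z)" by (cases t)
    from that have sub: "X \<subseteq> S" "Y \<subseteq> S" "Z \<subseteq> S" and eq: "card X = card Y" "card Y = card Z"
      and k: "card (X \<union> (S - Y)) = k"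
      by (auto simp: T_def t equicard_triples_def)
    note [simp] = sub[THEN fin] assms(1)
    have "X \<union> (S - Y) = S - (Y - X)" using sub by blast
    moreover have "Y - X \<subseteq> S" using sub by blast
    ultimately have U: "card (Y - X) = n - k"
      using k card_Diff_subset[of "Y - X" S] le[of "Y - X"] by (simp add: n_def)
    then have V: "card (X - Y) = n - k"
      using card_eq_iff_card_Diff_eq[of X Y] eq by simp
    have "card X = card (X \<inter> Y) + (n - k)"
      using card_Int_Diff[of X Y] V by simp
    moreover have "card (S - Z) = n - card Z" using sub by (simp add: card_Diff_subset n_def)
    ultimately have "card ((X \<inter> Y) <+> (S - Z)) = k"
      using eq le[OF sub(3)] assms(2) by (simp add: card_Plus n_def)
    then show "f t \<in> C" using U V sub by (auto simp: f_def C_def t)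
    show "g (f t) = t" using sub by (auto simp: f_def g_def t)
  qed
  have gT: "g c \<in> T" and fg: "f (g c) = c" if "c \<in> C" for c
  proof -
    obtain U V Q where c: "c = (U, V, Q)" by (cases c)
    define P R where "P = Inl -` Q" and "R = Inr -` Q"
    have "x \<in> Q \<longleftrightarrow> x \<in> P <+> R" for x
      by (cases x) (auto simp: P_def R_def)
    then have Q: "Q = P <+> R" by blast
    from that have sub: "U \<subseteq> S" "V \<subseteq> S - U" "P \<subseteq> S - U - V" "R \<subseteq> S"
      and cU: "card U = n - k" and cV: "card V = n - k" and k: "card (P <+> R) = k"
      by (auto simp: C_def c Q)
    have [simp]: "finite U" "finite V" "finite P" "finite R" "finite S"
      using sub by (auto intro!: fin)
    have g: "g c = (V \<union> P, U \<union> P, S - R)"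
      by (simp add: g_def c P_def R_def)
    have "card P + card R = k" using k by (simp add: card_Plus)
    moreover have "V \<inter> P = {}" "U \<inter> P = {}" using sub by blast+
    then have "card (V \<union> P) = n - k + card P" "card (U \<union> P) = n - k + card P"
      by (simp_all add: card_Un_disjoint cU cV)
    ultimately have "card (V \<union> P) = n - card R" "card (U \<union> P) = n - card R"
      using assms(2) by (auto simp: n_def)
    moreover have "card (S - R) = n - card R"
      using sub by (simp add: card_Diff_subset n_def)
    moreover have "V \<union> P \<union> (S - (U \<union> P)) = S - U" using sub by blast
    moreover have "card (S - U) = k"
      using sub cU assms(2) by (simp add: card_Diff_subset n_def)
    ultimately show "g c \<in> T"
      using sub unfolding g T_def equicard_triples_def by auto
    show "f (g c) = c"
      using sub unfolding g by (auto simp: f_def c Q)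
  qed
  have "bij_betw f T C"
    by (rule bij_betw_byWitness[where f' = g]) (use fC gf gT fg in blast)+
  then have "card T = card C" by (rule bij_betw_same_card)
  also have "card C = (n choose k) * ((k choose (n - k)) * ((2 * k) choose k))"
  proof -
    have *: "card {Q. Q \<subseteq> (S - U - V) <+> S \<and> card Q = k} = (2 * k choose k)"
      if "U \<subseteq> S" "card U = n - k" "V \<subseteq> S - U" "card V = n - k" for U V
    proof -
      have "finite U" "finite V" "V \<subseteq> S" using that by (auto intro!: fin)
      then have "card (S - U - V) = k - (n - k)" and "n - k \<le> k"
        using that assms card_mono[of "S - U" V] by (simp_all add: card_Diff_subset n_def)
      then have "card ((S - U - V) <+> S) = 2 * k"
        using assms by (simp add: card_Plus n_def)
      then show ?thesis using assms(1) by (simp add: n_subsets)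
    qed
    have **: "card {V. V \<subseteq> S - U \<and> card V = n - k} = (k choose (n - k))"
      if "U \<subseteq> S" "card U = n - k" for U
    proof -
      have "card (S - U) = k"
        using that assms(2) fin by (simp add: card_Diff_subset n_def)
      then show ?thesis using assms(1) by (simp add: n_subsets)
    qed
    have "card C = (\<Sum>U | U \<subseteq> S \<and> card U = n - k. \<Sum>V | V \<subseteq> S - U \<and> card V = n - k.
       card {Q. Q \<subseteq> (S - U - V) <+> S \<and> card Q = k})"
      unfolding C_def using assms(1)
      by (subst card_SigmaI; force simp: card_SigmaI intro!: finite_SigmaI)
    also have "\<dots> = (\<Sum>U | U \<subseteq> S \<and> card U = n - k. (k choose (n - k)) * ((2 * k) choose k))"
      by (simp add: * **)
    also have "\<dots> = (n choose (n - k)) * ((k choose (n - k)) * ((2 * k) choose k))"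
      using assms(1) by (simp add: n_subsets flip: n_def)
    finally show ?thesis
      using binomial_symmetric[of k n] assms(2) by (simp add: n_def)
  qed
  also have "\<dots> = (n choose k) ^ 2 * ((2 * k) choose n)"
    using choose_product_identity assms(2) n_def by blast
  finally show ?thesis by (simp add: T_def n_def)
qed

section \<open>Deals as triples\<close>

text \<open>
The three sets play cyclically symmetric roles: for the cycle red, green, blue, each set belongs to
the cards held by the player who precedes their color, and its complement to those held by the
player who follows it.
\<close>

fun deal_of_triple :: "nat \<Rightarrow> nat set \<times> nat set \<times> nat set \<Rightarrow> color \<Rightarrow> card set" where
  "deal_of_triple n (X, Y, Z) Red = {Green} \<times> X \<union> {Blue} \<times> ({1..n} - Y)"
| "deal_of_triple n (X, Y, Z) Green = {Blue} \<times> Y \<union> {Red} \<times> ({1..n} - Z)"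
| "deal_of_triple n (X, Y, Z) Blue = {Red} \<times> Z \<union> {Green} \<times> ({1..n} - X)"

lemma UNIV_color: "UNIV = {Red, Green, Blue}"
  using color.exhaust by auto

lemma all_color: "(\<forall>p. P p) \<longleftrightarrow> P Red \<and> P Green \<and> P Blue"
  by (metis color.exhaust)

text \<open>
Only the hand sizes are in question, and each hand compares two of the sets: its size is \<open>n\<close> plus
the size of one set minus the size of another.
\<close>

lemma deal_of_triple_in_franel_deals_iff:
  assumes "X \<subseteq> {1..n}" "Y \<subseteq> {1..n}" "Z \<subseteq> {1..n}"
  shows "deal_of_triple n (X, Y, Z) \<in> franel_deals n \<longleftrightarrow> (X, Y, Z) \<in> equicard_triples {1..n}"
proof -
  let ?d = "deal_of_triple n (X, Y, Z)"
  have hand: "card ({c} \<times> A \<union> {c'} \<times> ({1..n} - B)) = n \<longleftrightarrow> card A = card B"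
    if "A \<subseteq> {1..n}" "B \<subseteq> {1..n}" "c \<noteq> c'" for A B and c c' :: color
  proof -
    have "finite A" "finite B" using that finite_subset by blast+
    moreover have "card B \<le> n" using card_mono[OF _ that(2)] by simp
    ultimately show ?thesis
      using that by (subst card_Un_disjoint) (auto simp: card_cartesian_product card_Diff_subset)
  qed
  have "disjoint_family ?d"
    using assms by (simp add: disjoint_family_on_def all_color) auto
  moreover have "(\<Union>p. ?d p) = deck n"
    using assms by (auto simp: deck_def UNIV_color)
  moreover have "\<forall>p. \<forall>c \<in> ?d p. fst c \<noteq> p"
    by (auto simp: all_color)
  ultimately have "?d \<in> franel_deals n \<longleftrightarrow> (\<forall>p. card (?d p) = n)"
    unfolding franel_deals_def by blast
  also have "\<dots> \<longleftrightarrow> card X = card Y \<and> card Y = card Z \<and> card Z = card X"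
    by (simp only: all_color deal_of_triple.simps hand assms color.distinct simp_thms)
  finally show ?thesis
    using assms by (auto simp: equicard_triples_def)
qed

definition triple_of_deal :: "(color \<Rightarrow> card set) \<Rightarrow> nat set \<times> nat set \<times> nat set" where
  "triple_of_deal d = ({j. (Green, j) \<in> d Red}, {j. (Blue, j) \<in> d Green}, {j. (Red, j) \<in> d Blue})"

text \<open>
The hands are recovered because each card has only two possible owners, so that one of them holds
it iff the other does not.
\<close>

lemma deal_of_triple_of_deal:
  assumes "d \<in> franel_deals n"
  shows "deal_of_triple n (triple_of_deal d) = d" (is "?e = d")
proof
  have own: "fst c \<noteq> p" if "c \<in> d p" for c p
    using assms that by (auto simp: franel_deals_def)
  have disj: "p = q" if "c \<in> d p" "c \<in> d q" for c p q
    using assms that by (fastforce simp: franel_deals_def disjoint_family_on_def)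
  have dealt: "(\<exists>p. (c, j) \<in> d p) \<longleftrightarrow> j \<in> {1..n}" for c j
    using assms by (auto simp: franel_deals_def deck_def set_eq_iff)
  have other: "(c, j) \<in> d q \<longleftrightarrow> j \<in> {1..n} \<and> (c, j) \<notin> d p" if "c \<noteq> p" "c \<noteq> q" "p \<noteq> q" for c p q j
  proof -
    have "r = c \<or> r = p \<or> r = q" for r
      using that by (cases r; cases c; cases p; cases q; simp)
    then have "(\<exists>r. (c, j) \<in> d r) \<longleftrightarrow> (c, j) \<in> d p \<or> (c, j) \<in> d q"
      using own[of "(c, j)" c] by (metis fst_conv)
    then show ?thesis
      using dealt[of c j] disj[of "(c, j)" p q] that by blast
  qed
  have "(c, j) \<in> ?e p \<longleftrightarrow> (c, j) \<in> d p" for p c j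
    using own[of "(c, j)" c] other[of Blue Green Red j] other[of Red Blue Green j] other[of Green Red Blue j]
    by (cases p; cases c) (auto simp: triple_of_deal_def)
  then show "?e p = d p" for p by auto
qed

lemma bij_betw_deal_of_triple:
  "bij_betw (deal_of_triple n) (equicard_triples {1..n}) (franel_deals n)"
proof (rule bij_betwI')
  fix s t assume "s \<in> equicard_triples {1..n}" "t \<in> equicard_triples {1..n}"
  moreover obtain X Y Z X' Y' Z' where "s = (X, Y, Z)" "t = (X', Y', Z')"
    by (metis prod_cases3)
  ultimately show "(deal_of_triple n s = deal_of_triple n t) = (s = t)"
    by (auto simp: fun_eq_iff all_color set_eq_iff)
next
  fix t assume "t \<in> equicard_triples {1..n}"
  then show "deal_of_triple n t \<in> franel_deals n"
    by (cases t) (auto simp: deal_of_triple_in_franel_deals_iff equicard_triples_def)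
next
  fix d assume d: "d \<in> franel_deals n"
  have "\<forall>p. d p \<subseteq> deck n" using d by (auto simp: franel_deals_def)
  then have "triple_of_deal d \<in> equicard_triples {1..n}"
    using d deal_of_triple_of_deal[OF d] unfolding triple_of_deal_def
    by (subst deal_of_triple_in_franel_deals_iff[symmetric]) (auto simp: deck_def)
  then show "\<exists>t \<in> equicard_triples {1..n}. d = deal_of_triple n t"
    using deal_of_triple_of_deal[OF d] by metis
qed

lemma green_in_red_deal_of_triple: "green_in_red (deal_of_triple n (X, Y, Z)) = card X"
proof -
  have "{c \<in> deal_of_triple n (X, Y, Z) Red. fst c = Green} = {Green} \<times> X" by auto
  then have "green_in_red (deal_of_triple n (X, Y, Z)) = card ({Green} \<times> X)"
    unfolding green_in_red_def by (rule arg_cong)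
  then show ?thesis by (simp add: card_cartesian_product)
qed

lemma denominations_in_red_deal_of_triple:
  "denominations_in_red (deal_of_triple n (X, Y, Z)) = card (X \<union> ({1..n} - Y))"
proof -
  have "snd ` deal_of_triple n (X, Y, Z) Red = X \<union> ({1..n} - Y)" by force
  then show ?thesis by (simp add: denominations_in_red_def)
qed

section \<open>Abelian matrices as triples\<close>

text \<open>Keeps \<open>1\<close>, as an entry and as a row index, in the form in which the lemmas below match it.\<close>

declare One_nat_def [simp del]

text \<open>
The column of \<open>j\<close> as a function of the truth values \<open>x\<close>, \<open>y\<close>, \<open>z\<close> of \<open>j \<in> X\<close>, \<open>j \<in> Y\<close>, \<open>j \<in> Z\<close>.
In the notation top-bottom, the members of \<open>X\<close> are the columns 21, 31, 22, 32, those of \<open>Y\<close> are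
12, 13, 22, 32, and those of \<open>Z\<close> are 21, 22, 13, 23; column 33 belongs to none.

The set \<open>X\<close> is dictated by the first statistic. For \<open>Y\<close>, the columns 21 and 31 of \<open>X\<close> with a one at
the bottom are exchanged for the columns 12 and 13 with a one on top, so that equality of \<open>card X\<close>
and \<open>card Y\<close> balances the ones. For \<open>Z\<close>, the columns 12 and 32 of \<open>Y\<close> are exchanged for 21 and 23,
which balances the twos.
\<close>

definition top_entry :: "bool \<Rightarrow> bool \<Rightarrow> bool \<Rightarrow> nat" where
  "top_entry x y z = (if y \<and> \<not> x then 1 else if z then 2 else 3)"

definition bottom_entry :: "bool \<Rightarrow> bool \<Rightarrow> bool \<Rightarrow> nat" where
  "bottom_entry x y z = (if x \<and> \<not> y then 1 else if y \<and> \<not> (z \<and> \<not> x) then 2 else 3)"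

lemma top_entry_eq_iff:
  "top_entry x y z = 1 \<longleftrightarrow> y \<and> \<not> x"
  "top_entry x y z = 2 \<longleftrightarrow> z \<and> \<not> (y \<and> \<not> x)"
  "top_entry x y z = 3 \<longleftrightarrow> \<not> z \<and> \<not> (y \<and> \<not> x)"
  by (auto simp: top_entry_def)

lemma bottom_entry_eq_iff:
  "bottom_entry x y z = 1 \<longleftrightarrow> x \<and> \<not> y"
  "bottom_entry x y z = 2 \<longleftrightarrow> y \<and> \<not> (z \<and> \<not> x)"
  "bottom_entry x y z = 3 \<longleftrightarrow> \<not> (x \<and> \<not> y) \<and> \<not> (y \<and> \<not> (z \<and> \<not> x))"
  by (auto simp: bottom_entry_def)

lemma column_determines_memberships:
  assumes "top_entry x y z = top_entry x' y' z'" "bottom_entry x y z = bottom_entry x' y' z'"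
  shows "x = x' \<and> y = y' \<and> z = z'"
  using assms unfolding top_entry_def bottom_entry_def
  by (cases x; cases y; cases z; cases x'; cases y'; cases z'; simp)

lemma top_gt_1_bottom_lt_3_iff: "top_entry x y z > 1 \<and> bottom_entry x y z < 3 \<longleftrightarrow> x"
  unfolding top_entry_def bottom_entry_def by (cases x; cases y; cases z; simp)

definition matrix_of_triple :: "nat \<Rightarrow> nat set \<times> nat set \<times> nat set \<Rightarrow> nat mat" where
  "matrix_of_triple n = (\<lambda>(X, Y, Z). mat 2 n (\<lambda>(i, j).
     (if i = 0 then top_entry else bottom_entry) (j \<in> X) (j \<in> Y) (j \<in> Z)))"

lemma matrix_of_triple_dim [simp]:
  "dim_row (matrix_of_triple n t) = 2" "dim_col (matrix_of_triple n t) = n"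
  "matrix_of_triple n t \<in> carrier_mat 2 n"
  by (cases t; simp add: matrix_of_triple_def)+

lemma matrix_of_triple_index [simp]:
  assumes "j < n"
  shows "matrix_of_triple n (X, Y, Z) $$ (0, j) = top_entry (j \<in> X) (j \<in> Y) (j \<in> Z)"
    and "matrix_of_triple n (X, Y, Z) $$ (1, j) = bottom_entry (j \<in> X) (j \<in> Y) (j \<in> Z)"
  using assms by (simp_all add: matrix_of_triple_def)

lemma count_row:
  assumes "i < dim_row M"
  shows "count (mset (list_of_vec (row M i))) v = card {j. j < dim_col M \<and> M $$ (i, j) = v}"
proof -
  have "list_of_vec (row M i) = map (\<lambda>j. M $$ (i, j)) [0..<dim_col M]"
    using assms by (intro nth_equalityI) (auto simp: list_of_vec_index)
  then have "count (mset (list_of_vec (row M i))) v = length (filter (\<lambda>j. v = M $$ (i, j)) [0..<dim_col M])"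
    by (simp only: count_mset count_list_eq_length_filter filter_map comp_def length_map)
  also have "\<dots> = card (set (filter (\<lambda>j. v = M $$ (i, j)) [0..<dim_col M]))"
    by (rule distinct_card[symmetric]) simp
  also have "set (filter (\<lambda>j. v = M $$ (i, j)) [0..<dim_col M]) = {j. j < dim_col M \<and> M $$ (i, j) = v}"
    by auto
  finally show ?thesis .
qed

lemma card_partition_three:
  fixes h :: "nat \<Rightarrow> nat"
  assumes "\<And>j. j < n \<Longrightarrow> h j \<in> {1, 2, 3}"
  shows "card {j. j < n \<and> h j = 1} + card {j. j < n \<and> h j = 2} + card {j. j < n \<and> h j = 3} = n"
proof -
  have "n = card ({j. j < n \<and> h j = 1} \<union> {j. j < n \<and> h j = 2} \<union> {j. j < n \<and> h j = 3})"
    using assms by (subst card_lessThan[symmetric], intro arg_cong[where f = card]) auto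
  also have "\<dots> = card {j. j < n \<and> h j = 1} + card {j. j < n \<and> h j = 2} + card {j. j < n \<and> h j = 3}"
    by (subst card_Un_disjoint; (subst card_Un_disjoint)?; auto)
  finally show ?thesis by simp
qed

text \<open>
The rows have equal length and only three values occur, so the number of threes takes care of
itself.
\<close>

lemma abelian_matrices_iff:
  assumes M: "M \<in> carrier_mat 2 n" and ent: "\<And>i j. i < 2 \<Longrightarrow> j < n \<Longrightarrow> M $$ (i, j) \<in> {1, 2, 3}"
  shows "M \<in> abelian_matrices n \<longleftrightarrow>
    (\<forall>v \<in> {1, 2}. card {j. j < n \<and> M $$ (1, j) = v} = card {j. j < n \<and> M $$ (0, j) = v})"
    (is "_ \<longleftrightarrow> (\<forall>v \<in> _. ?c 1 v = ?c 0 v)")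
proof -
  have "elements_mat M \<subseteq> {1, 2, 3}"
  proof
    fix x assume "x \<in> elements_mat M"
    then obtain i j where "i < 2" "j < n" "x = M $$ (i, j)"
      using M unfolding elements_mat_def by auto
    then show "x \<in> {1, 2, 3}" using ent by blast
  qed
  then have "M \<in> abelian_matrices n \<longleftrightarrow> (\<forall>v. ?c 1 v = ?c 0 v)"
    using M by (simp add: abelian_matrices_def multiset_eq_iff count_row)
  also have "\<dots> \<longleftrightarrow> (\<forall>v \<in> {1, 2}. ?c 1 v = ?c 0 v)"
  proof
    assume *: "\<forall>v \<in> {1, 2}. ?c 1 v = ?c 0 v"
    have "?c i 1 + ?c i 2 + ?c i 3 = n" if "i < 2" for i
      by (rule card_partition_three) (use ent that in blast)
    from this[of 0] this[of 1] have three: "?c 1 3 = ?c 0 3"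
      using * by simp
    have empty: "?c i v = 0" if "v \<notin> {1, 2, 3}" "i < 2" for i v
    proof -
      have "{j. j < n \<and> M $$ (i, j) = v} = {}" using that ent by blast
      then show ?thesis by (simp only: card.empty)
    qed
    show "\<forall>v. ?c 1 v = ?c 0 v"
    proof
      fix v :: nat
      consider "v \<in> {1, 2}" | "v = 3" | "v \<notin> {1, 2, 3}" by blast
      then show "?c 1 v = ?c 0 v"
      proof cases
        case 1
        then show ?thesis using * by blast
      next
        case 2
        then show ?thesis using three by blast
      next
        case 3
        then have "?c 0 v = 0" "?c 1 v = 0" by (rule empty, simp)+
        then show ?thesis by (simp only:)
      qed
    qed
  qed simp
  finally show ?thesis .
qed

text \<open>
The ones are at \<open>Y - X\<close> on top and at \<open>X - Y\<close> below, the twos at \<open>Z - (Y - X)\<close> and \<open>Y - (Z - X)\<close>.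
Both of the latter sets arise from \<open>Z\<close> and from \<open>Y\<close> by removing \<open>(Y \<inter> Z) - X\<close>, so they compare
the sizes of \<open>Y\<close> and \<open>Z\<close>.
\<close>

lemma matrix_of_triple_in_abelian_matrices_iff:
  assumes "X \<subseteq> {..<n}" "Y \<subseteq> {..<n}" "Z \<subseteq> {..<n}"
  shows "matrix_of_triple n (X, Y, Z) \<in> abelian_matrices n \<longleftrightarrow> (X, Y, Z) \<in> equicard_triples {..<n}"
proof -
  let ?M = "matrix_of_triple n (X, Y, Z)"
  have [simp]: "finite X" "finite Y" "finite Z" using assms finite_subset by blast+
  have 1: "{j. j < n \<and> ?M $$ (0, j) = 1} = Y - X" "{j. j < n \<and> ?M $$ (1, j) = 1} = X - Y"
    using assms by (auto simp: top_entry_eq_iff bottom_entry_eq_iff cong: conj_cong)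
  have 2: "{j. j < n \<and> ?M $$ (0, j) = 2} = Z - (Y - X)" "{j. j < n \<and> ?M $$ (1, j) = 2} = Y - (Z - X)"
    using assms by (auto simp: top_entry_eq_iff bottom_entry_eq_iff cong: conj_cong)
  have "card Y = card Z \<longleftrightarrow> card (Y - (Z - X)) = card (Z - (Y - X))"
  proof -
    have "Y \<inter> (Z - X) = Z \<inter> (Y - X)" by auto
    then show ?thesis
      using card_Int_Diff[of Y "Z - X"] card_Int_Diff[of Z "Y - X"] by simp
  qed
  moreover have "?M \<in> abelian_matrices n \<longleftrightarrow>
      card (X - Y) = card (Y - X) \<and> card (Y - (Z - X)) = card (Z - (Y - X))"
  proof (subst abelian_matrices_iff)
    show "?M $$ (i, j) \<in> {1, 2, 3}" if "i < 2" "j < n" for i j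
    proof -
      have "i = 0 \<or> i = 1" using that by auto
      then show ?thesis
        using that(2) by (elim disjE) (simp_all add: top_entry_def bottom_entry_def)
    qed
  qed (simp_all add: 1 2)
  ultimately show ?thesis
    using assms card_eq_iff_card_Diff_eq[of X Y] by (auto simp: equicard_triples_def)
qed

definition triple_of_matrix :: "nat \<Rightarrow> nat mat \<Rightarrow> nat set \<times> nat set \<times> nat set" where
  "triple_of_matrix n M =
    ({j. j < n \<and> M $$ (0, j) > 1 \<and> M $$ (1, j) < 3},
     {j. j < n \<and> (M $$ (0, j) = 1 \<or> M $$ (1, j) = 2)},
     {j. j < n \<and> (M $$ (0, j) = 2 \<or> M $$ (0, j) = 1 \<and> M $$ (1, j) = 3)})"

lemma matrix_of_triple_of_matrix:
  assumes "M \<in> abelian_matrices n" "no_column_11 M"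
  shows "matrix_of_triple n (triple_of_matrix n M) = M" (is "?N = M")
proof (rule eq_matI)
  have M: "M \<in> carrier_mat 2 n" and ent: "elements_mat M \<subseteq> {1, 2, 3}"
    using assms(1) by (simp_all add: abelian_matrices_def)
  then have dim: "dim_row M = 2" "dim_col M = n" by simp_all
  show "dim_row ?N = dim_row M" "dim_col ?N = dim_col M" by (simp_all add: dim)
  fix i j assume "i < dim_row M" "j < dim_col M"
  then have ij: "i = 0 \<or> i = 1" "j < n" by (auto simp: dim)
  have "M $$ (0, j) \<in> {1, 2, 3}" "M $$ (1, j) \<in> {1, 2, 3}"
    by (rule subsetD[OF ent elements_matI[OF M _ ij(2) refl]], simp)+
  moreover have "\<not> (M $$ (0, j) = 1 \<and> M $$ (1, j) = 1)"
    using assms(2) ij dim by (auto simp: no_column_11_def)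
  ultimately show "?N $$ (i, j) = M $$ (i, j)"
    using ij by (auto simp: triple_of_matrix_def top_entry_def bottom_entry_def)
qed

lemma bij_betw_matrix_of_triple:
  "bij_betw (matrix_of_triple n) (equicard_triples {..<n}) {M \<in> abelian_matrices n. no_column_11 M}"
proof (rule bij_betwI')
  fix s t assume "s \<in> equicard_triples {..<n}" "t \<in> equicard_triples {..<n}"
  moreover obtain X Y Z X' Y' Z' where st: "s = (X, Y, Z)" "t = (X', Y', Z')"
    by (metis prod_cases3)
  ultimately have sub: "X \<subseteq> {..<n}" "Y \<subseteq> {..<n}" "Z \<subseteq> {..<n}" "X' \<subseteq> {..<n}" "Y' \<subseteq> {..<n}" "Z' \<subseteq> {..<n}"
    by (auto simp: equicard_triples_def)
  show "(matrix_of_triple n s = matrix_of_triple n t) = (s = t)"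
  proof
    assume eq: "matrix_of_triple n s = matrix_of_triple n t"
    have "(j \<in> X \<longleftrightarrow> j \<in> X') \<and> (j \<in> Y \<longleftrightarrow> j \<in> Y') \<and> (j \<in> Z \<longleftrightarrow> j \<in> Z')" if "j < n" for j
    proof -
      have "matrix_of_triple n s $$ (0, j) = matrix_of_triple n t $$ (0, j)"
        "matrix_of_triple n s $$ (1, j) = matrix_of_triple n t $$ (1, j)"
        by (simp_all only: eq)
      then show ?thesis
        using that by (intro column_determines_memberships) (simp_all add: st)
    qed
    then show "s = t" using sub unfolding st by blast
  qed simp
next
  fix t assume "t \<in> equicard_triples {..<n}"
  then show "matrix_of_triple n t \<in> {M \<in> abelian_matrices n. no_column_11 M}"
    using matrix_of_triple_in_abelian_matrices_iff[of "fst t" n "fst (snd t)" "snd (snd t)"]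
    by (auto simp: equicard_triples_def no_column_11_def top_entry_eq_iff bottom_entry_eq_iff)
next
  fix M assume "M \<in> {M \<in> abelian_matrices n. no_column_11 M}"
  then have M: "M \<in> abelian_matrices n" "no_column_11 M" by auto
  have "triple_of_matrix n M \<in> equicard_triples {..<n}"
    using M matrix_of_triple_of_matrix[OF M] unfolding triple_of_matrix_def
    by (subst matrix_of_triple_in_abelian_matrices_iff[symmetric]) auto
  then show "\<exists>t \<in> equicard_triples {..<n}. M = matrix_of_triple n t"
    using matrix_of_triple_of_matrix[OF M] by metis
qed

lemma card_top_gt_1_bottom_lt_3:
  assumes "X \<subseteq> {..<n}"
  shows "card {j. j < n \<and> matrix_of_triple n (X, Y, Z) $$ (0, j) > 1
    \<and> matrix_of_triple n (X, Y, Z) $$ (1, j) < 3} = card X"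
  by (rule arg_cong[where f = card]) (use assms in \<open>auto simp: top_gt_1_bottom_lt_3_iff cong: conj_cong\<close>)

text \<open>
The entries different from one are missing at \<open>Y - X\<close> in the top row and at \<open>X - Y\<close> in the bottom
row; these have the same size since \<open>X\<close> and \<open>Y\<close> do.
\<close>

lemma card_large_entries_matrix_of_triple:
  assumes "(X, Y, Z) \<in> equicard_triples {..<n}" "i < 2"
  shows "card {j. j < n \<and> matrix_of_triple n (X, Y, Z) $$ (i, j) \<in> {2, 3}} = card (X \<union> ({..<n} - Y))"
    (is "card (?J i) = _")
proof -
  have sub: "X \<subseteq> {..<n}" "Y \<subseteq> {..<n}" and "card X = card Y"
    using assms(1) by (auto simp: equicard_triples_def)
  have fin: "finite X" "finite Y" using sub finite_subset by blast+
  then have "card (X - Y) = card (Y - X)"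
    using \<open>card X = card Y\<close> card_eq_iff_card_Diff_eq by blast
  moreover have "?J 0 = {..<n} - (Y - X)" "?J 1 = {..<n} - (X - Y)"
    by (auto simp: top_entry_eq_iff bottom_entry_eq_iff cong: conj_cong)
  moreover have "X \<union> ({..<n} - Y) = {..<n} - (Y - X)"
    using sub by blast
  moreover have "card ({..<n} - (Y - X)) = n - card (Y - X)" "card ({..<n} - (X - Y)) = n - card (X - Y)"
    using sub fin by (subst card_Diff_subset; auto)+
  ultimately have "card (?J 0) = card (X \<union> ({..<n} - Y))" "card (?J 1) = card (X \<union> ({..<n} - Y))"
    by (simp_all only:)
  moreover have "i = 0 \<or> i = 1" using assms(2) by auto
  ultimately show ?thesis by (elim disjE) (simp_all only:)
qed

section \<open>Counting\<close>

lemma card_eq_sum_card_fibres: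
  assumes "finite A" "\<And>a. a \<in> A \<Longrightarrow> s a \<le> n"
  shows "card A = (\<Sum>k = 0..n. card {a \<in> A. s a = (k :: nat)})"
proof -
  have "s ` A \<subseteq> {0..n}" using assms(2) by auto
  from sum.group[OF assms(1) finite_atLeastAtMost this, of "\<lambda>_. 1 :: nat"]
  show ?thesis by simp
qed

theorem mainTheorem3:
  fixes n :: nat
  shows "(\<forall>k \<le> n.
      card {d \<in> franel_deals n. green_in_red d = k} = (n choose k) ^ 3
    \<and> card {M \<in> abelian_matrices n. no_column_11 M \<and>
          card {j. j < n \<and> M $$ (0, j) > 1 \<and> M $$ (1, j) < 3} = k} = (n choose k) ^ 3
    \<and> card {d \<in> franel_deals n. denominations_in_red d = k} = (n choose k) ^ 2 * ((2 * k) choose n)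
    \<and> card {M \<in> abelian_matrices n. no_column_11 M \<and>
          (\<forall>i < 2. card {j. j < n \<and> M $$ (i, j) \<in> {2, 3}} = k)} = (n choose k) ^ 2 * ((2 * k) choose n))
    \<and> card (franel_deals n) = (\<Sum>k = 0..n. (n choose k) ^ 3)
    \<and> card (franel_deals n) = (\<Sum>k = 0..n. (n choose k) ^ 2 * ((2 * k) choose n))
    \<and> (\<Sum>k = 0..n. (n choose k) ^ 3) = (\<Sum>k = 0..n. (n choose k) ^ 2 * ((2 * k) choose n))"
proof -
  have deals_a: "card {d \<in> franel_deals n. green_in_red d = k} = (n choose k) ^ 3" for k
  proof -
    have "card {d \<in> franel_deals n. green_in_red d = k}
        = card {t \<in> equicard_triples {1..n}. case t of (X, Y, Z) \<Rightarrow> card X = k}"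
      by (rule bij_betw_same_card[OF bij_betw_Collect[OF bij_betw_deal_of_triple], symmetric])
        (auto simp: green_in_red_deal_of_triple)
    also have "\<dots> = (n choose k) ^ 3"
      using card_equicard_triples_by_size[of "{1..n}" k] by (simp add: case_prod_unfold)
    finally show ?thesis .
  qed
  have deals_b: "card {d \<in> franel_deals n. denominations_in_red d = k} = (n choose k) ^ 2 * ((2 * k) choose n)"
    if "k \<le> n" for k
  proof -
    have "card {d \<in> franel_deals n. denominations_in_red d = k}
        = card {t \<in> equicard_triples {1..n}. case t of (X, Y, Z) \<Rightarrow> card (X \<union> ({1..n} - Y)) = k}"
      by (rule bij_betw_same_card[OF bij_betw_Collect[OF bij_betw_deal_of_triple], symmetric])
        (auto simp: denominations_in_red_deal_of_triple)
    also have "\<dots> = (n choose k) ^ 2 * ((2 * k) choose n)"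
      using card_equicard_triples_by_union[of "{1..n}" k] that by (simp add: case_prod_unfold)
    finally show ?thesis .
  qed
  have matrices_a: "card {M \<in> abelian_matrices n. no_column_11 M \<and>
      card {j. j < n \<and> M $$ (0, j) > 1 \<and> M $$ (1, j) < 3} = k} = (n choose k) ^ 3" for k
  proof -
    have "card {M \<in> {M \<in> abelian_matrices n. no_column_11 M}.
        card {j. j < n \<and> M $$ (0, j) > 1 \<and> M $$ (1, j) < 3} = k}
        = card {t \<in> equicard_triples {..<n}. case t of (X, Y, Z) \<Rightarrow> card X = k}"
      by (rule bij_betw_same_card[OF bij_betw_Collect[OF bij_betw_matrix_of_triple], symmetric])
        (auto simp: card_top_gt_1_bottom_lt_3 equicard_triples_def simp del: One_nat_def)
    also have "\<dots> = (n choose k) ^ 3"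
      using card_equicard_triples_by_size[of "{..<n}" k] by (simp add: case_prod_unfold)
    finally show ?thesis by simp
  qed
  have matrices_b: "card {M \<in> abelian_matrices n. no_column_11 M \<and>
      (\<forall>i < 2. card {j. j < n \<and> M $$ (i, j) \<in> {2, 3}} = k)} = (n choose k) ^ 2 * ((2 * k) choose n)"
    if "k \<le> n" for k
  proof -
    \<comment> \<open>Guards against a vacuous quantification over the two rows.\<close>
    have ex: "\<exists>i :: nat. i < 2" by (rule exI[of _ 0]) simp
    have "card {M \<in> {M \<in> abelian_matrices n. no_column_11 M}.
        \<forall>i < 2. card {j. j < n \<and> M $$ (i, j) \<in> {2, 3}} = k}
        = card {t \<in> equicard_triples {..<n}. case t of (X, Y, Z) \<Rightarrow> card (X \<union> ({..<n} - Y)) = k}"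
      by (rule bij_betw_same_card[OF bij_betw_Collect[OF bij_betw_matrix_of_triple], symmetric])
        (use ex in \<open>auto simp: card_large_entries_matrix_of_triple simp del: insert_iff\<close>)
    also have "\<dots> = (n choose k) ^ 2 * ((2 * k) choose n)"
      using card_equicard_triples_by_union[of "{..<n}" k] that by (simp add: case_prod_unfold)
    finally show ?thesis by simp
  qed
  have fin: "finite (franel_deals n)"
    using bij_betw_finite[OF bij_betw_deal_of_triple] finite_equicard_triples by blast
  have le: "green_in_red d \<le> n \<and> denominations_in_red d \<le> n" if "d \<in> franel_deals n" for d
  proof -
    have "card (d Red) = n" "finite (deck n)" "d Red \<subseteq> deck n"
      using that by (auto simp: franel_deals_def deck_def UNIV_color)
    then have "finite (d Red)" "card (d Red) = n" using finite_subset by auto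
    then show ?thesis
      using card_mono[of "d Red" "{c \<in> d Red. fst c = Green}"] card_image_le[of "d Red" snd]
      by (auto simp: green_in_red_def denominations_in_red_def)
  qed
  have "card (franel_deals n) = (\<Sum>k = 0..n. (n choose k) ^ 3)"
    using card_eq_sum_card_fibres[OF fin, of green_in_red n] le by (simp add: deals_a)
  moreover have "card (franel_deals n) = (\<Sum>k = 0..n. (n choose k) ^ 2 * ((2 * k) choose n))"
    using card_eq_sum_card_fibres[OF fin, of denominations_in_red n] le by (simp add: deals_b)
  ultimately show ?thesis
    using deals_a deals_b matrices_a matrices_b by simp
qed

end
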